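(* Let $\mathcal M$ be a strongly pseudo-unitary $\mathcal A$-module, i.e. a topological $\mathcal A$-module equipped with a strongly non-degenerate $*$-representation $\pi_\nu$ of $(\mathcal A,* )$. Then the characteristic variety $V(\mathcal M)\subset\mathbb C^d$ is real, i.e. it is the set of common zeros of finitely many polynomials with real coefficients. If moreover $\mathcal M$ is without torsion (multiplication by $\nu$ is injective), then the Poisson characteristic variety $V\!A(\mathcal M)\subset\mathbb C^d$ is real in the same sense.
   Context: Setting. $V=\mathbb R^d$ carries a polynomial Poisson structure (a bivector field $P$ with real polynomial coefficients and $[P,P]=0$). $A=\mathbb C[x_1,\dots,x_d]$ is the algebra of polynomials on $V^{\mathbb C}=\mathbb C^d$, with the Poisson bracket $\{\cdot,\cdot\}$ extended $\mathbb C$-bilinearly. $\mathcal A=A[[\nu]]$ is equipped with the Duflo–Kontsevich star product $*$: an associative $\mathbb C[[\nu]]$-bilinear product given for $f,g\in A$ by $f*g=fg+\sum_{k\ge1}\nu^kC_k(f,g)$, where the $C_k$ are bidifferential operators with real polynomial coefficients and $f*g-g*f=\nu\{f,g\}+O(\nu^2)$; it is equivalent to Kontsevich's star product and satisfies $f*g=fg$ for $f,g$ in the center of $(\mathcal A,* )$. One identifies $A$ with $\mathcal A/\nu\mathcal A$. Complex conjugation is extended to $\mathbb C[[\nu]]$ by $\overline\nu=-\nu$. The involution $f\mapsto f^*$ of $\mathcal A$, $f^*(\xi)=\overline{f(\overline\xi)}$, i.e. $(\sum\nu^kf_k)^*=\sum(-\nu)^kf_k^*$ with $f_k^*(\xi)=\overline{f_k(\overline\xi)}$,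 is a semilinear anti-automorphism of $(\mathcal A,* )$. A topological $\mathcal A$-module is a $\mathbb C[[\nu]]$-module $\mathcal M$ with a $\mathbb C[[\nu]]$-bilinear map $\mathcal A\times\mathcal M\to\mathcal M$, $(\varphi,m)\mapsto\pi_\nu(\varphi)m$, making it a left $\mathcal A$-module. $\pi_\nu$ is a $*$-representation if there is a non-degenerate hermitian form $\langle\cdot,\cdot\rangle_\nu$ on $\mathcal M$ with values in $\mathbb C[[\nu]]$, sesquilinear with respect to the conjugation of $\mathbb C[[\nu]]$ (no positivity assumed, $\langle m,n\rangle_\nu=\overline{\langle n,m\rangle_\nu}$), with $\langle\pi_\nu(f)u,v\rangle_\nu=\langle u,\pi_\nu(f^* )v\rangle_\nu$ for all $f\in\mathcal A$, $u,v\in\mathcal M$. It is strongly non-degenerate if moreover the induced $\mathbb C$-valued form on $M=\mathcal M/\nu\mathcal M$ is non-degenerate. $V(\mathcal M)$ is the set of common zeros in $\mathbb C^d$ of the annihilator in $A$ of the $A$-module $\mathcal M/\nu\mathcal M$. $V\!A(\mathcal M)$ is the set of common zeros in $\mathbb C^d$ of the ideal $\operatorname{Ann}\mathcal M/(\operatorname{Ann}\mathcal M\cap\nu\mathcal A)$ of $A$, where $\operatorname{Ann}\mathcal M=\{\varphi\in\mathcal A:\pi_\nu(\varphi)m=0\ \forall m\in\mathcal M\}$. *)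

theory Defs
  imports "HOL-Analysis.Analysis" "HOL-Library.Poly_Mapping" "HOL-Combinatorics.Permutations"
begin

section \<open>Complex polynomials in the coordinates indexed by a finite type\<close>

text \<open>
  The dimension \<open>d\<close> is \<open>CARD('d)\<close>. A polynomial is the finitely supported family of its
  coefficients, indexed by exponent vectors; the multiplication of \<^theory>\<open>HOL-Library.Poly_Mapping\<close>
  is convolution, i.e. the usual product of polynomials.
\<close>

type_synonym 'd mpoly = "('d \<Rightarrow>\<^sub>0 nat) \<Rightarrow>\<^sub>0 complex"

abbreviation cst :: "complex \<Rightarrow> 'd mpoly" where
  "cst c \<equiv> Poly_Mapping.single 0 c"

definition mderiv :: "'d \<Rightarrow> 'd mpoly \<Rightarrow> 'd mpoly" where
  "mderiv i f =
     (\<Sum>m\<in>Poly_Mapping.keys f.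
        Poly_Mapping.single (m - Poly_Mapping.single i 1)
          (of_nat (Poly_Mapping.lookup m i) * Poly_Mapping.lookup f m))"

text \<open>Iterated partial derivatives; the order in the list of indices is immaterial.\<close>

abbreviation mderivs :: "'d list \<Rightarrow> 'd mpoly \<Rightarrow> 'd mpoly" where
  "mderivs \<alpha> f \<equiv> foldr mderiv \<alpha> f"

definition peval :: "'d::finite mpoly \<Rightarrow> complex ^ 'd \<Rightarrow> complex" where
  "peval f \<xi> =
     (\<Sum>m\<in>Poly_Mapping.keys f.
        Poly_Mapping.lookup f m * (\<Prod>i\<in>UNIV. vec_nth \<xi> i ^ Poly_Mapping.lookup m i))"

definition real_poly :: "'d mpoly \<Rightarrow> bool" where
  "real_poly f \<longleftrightarrow> (\<forall>m. Poly_Mapping.lookup f m \<in> \<real>)"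

definition pcnj :: "'d mpoly \<Rightarrow> 'd mpoly" where
  "pcnj f = Poly_Mapping.map cnj f"

text \<open>The coefficientwise definition of \<open>pcnj\<close> is the involution \<open>f\<^sup>*(\<xi>) = cnj (f (cnj \<xi>))\<close>:\<close>

lemma peval_pcnj: "peval (pcnj f) \<xi> = cnj (peval f (\<chi> i. cnj (vec_nth \<xi> i)))"
proof -
  have lk: "Poly_Mapping.lookup (pcnj f) m = cnj (Poly_Mapping.lookup f m)" for m
    by (simp add: pcnj_def Poly_Mapping.map.rep_eq when_def)
  have "Poly_Mapping.keys (pcnj f) = Poly_Mapping.keys f"
    by (auto simp: in_keys_iff lk)
  then show ?thesis
    by (simp add: peval_def lk)
qed

definition zeros :: "'d::finite mpoly set \<Rightarrow> (complex ^ 'd) set" where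
  "zeros S = {\<xi>. \<forall>f\<in>S. peval f \<xi> = 0}"

definition real_variety :: "(complex ^ 'd::finite) set \<Rightarrow> bool" where
  "real_variety X \<longleftrightarrow> (\<exists>S. finite S \<and> (\<forall>f\<in>S. real_poly f) \<and> X = zeros S)"

section \<open>Polynomial Poisson structures\<close>

definition bracket :: "('d::finite \<Rightarrow> 'd \<Rightarrow> 'd mpoly) \<Rightarrow> 'd mpoly \<Rightarrow> 'd mpoly \<Rightarrow> 'd mpoly" where
  "bracket P f g = (\<Sum>i\<in>UNIV. \<Sum>j\<in>UNIV. P i j * mderiv i f * mderiv j g)"

text \<open>
  \<open>P i j\<close> is the bracket of the \<open>i\<close>-th and \<open>j\<close>-th coordinate functions. The last conjunct is
  \<open>[P,P] = 0\<close> written in coordinates, for the Schouten bracket.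
\<close>

definition poisson_structure :: "('d::finite \<Rightarrow> 'd \<Rightarrow> 'd mpoly) \<Rightarrow> bool" where
  "poisson_structure P \<longleftrightarrow>
     (\<forall>i j. real_poly (P i j)) \<and>
     (\<forall>i j. P i j = - P j i) \<and>
     (\<forall>i j k. (\<Sum>l\<in>UNIV. P i l * mderiv l (P j k) + P j l * mderiv l (P k i)
                          + P k l * mderiv l (P i j)) = 0)"

section \<open>Differential operators and formal products\<close>

definition diff_operator :: "('d mpoly \<Rightarrow> 'd mpoly) \<Rightarrow> bool" where
  "diff_operator D \<longleftrightarrow>
     (\<exists>S c. finite S \<and> (\<forall>f. D f = (\<Sum>\<alpha>\<in>S. c \<alpha> * mderivs \<alpha> f)))"

definition real_bidiff_operator :: "('d mpoly \<Rightarrow> 'd mpoly \<Rightarrow> 'd mpoly) \<Rightarrow> bool" where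
  "real_bidiff_operator B \<longleftrightarrow>
     (\<exists>S c. finite S \<and> (\<forall>(\<alpha>, \<beta>)\<in>S. real_poly (c \<alpha> \<beta>)) \<and>
        (\<forall>f g. B f g = (\<Sum>(\<alpha>, \<beta>)\<in>S. c \<alpha> \<beta> * mderivs \<alpha> f * mderivs \<beta> g)))"

text \<open>
  Power series in \<open>\<nu>\<close> are of type \<open>fps\<close>, whose multiplication \<open>*\<close> is the undeformed one.
  \<open>star C\<close> is the product of \<open>A[[\<nu>]]\<close> which on \<open>A\<close> is \<open>\<Sum>k. \<nu>\<^sup>k C k f g\<close>.
\<close>

definition star ::
    "(nat \<Rightarrow> 'd mpoly \<Rightarrow> 'd mpoly \<Rightarrow> 'd mpoly) \<Rightarrow> 'd mpoly fps \<Rightarrow> 'd mpoly fps \<Rightarrow> 'd mpoly fps" where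
  "star C F G =
     Abs_fps (\<lambda>n. \<Sum>k\<le>n. \<Sum>i\<le>n - k. C k (fps_nth F i) (fps_nth G (n - k - i)))"

definition formal_op :: "(nat \<Rightarrow> 'd mpoly \<Rightarrow> 'd mpoly) \<Rightarrow> 'd mpoly fps \<Rightarrow> 'd mpoly fps" where
  "formal_op T F = Abs_fps (\<lambda>n. \<Sum>k\<le>n. T k (fps_nth F (n - k)))"

definition star_equivalent ::
    "(nat \<Rightarrow> 'd mpoly \<Rightarrow> 'd mpoly \<Rightarrow> 'd mpoly) \<Rightarrow> (nat \<Rightarrow> 'd mpoly \<Rightarrow> 'd mpoly \<Rightarrow> 'd mpoly) \<Rightarrow> bool" where
  "star_equivalent C C' \<longleftrightarrow>
     (\<exists>T. T 0 = (\<lambda>f. f) \<and> (\<forall>k\<ge>1. diff_operator (T k)) \<and>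
          (\<forall>F G. formal_op T (star C F G) = star C' (formal_op T F) (formal_op T G)))"

definition star_center ::
    "(nat \<Rightarrow> 'd mpoly \<Rightarrow> 'd mpoly \<Rightarrow> 'd mpoly) \<Rightarrow> 'd mpoly fps set" where
  "star_center C = {F. \<forall>G. star C F G = star C G F}"

definition fps_conj :: "complex fps \<Rightarrow> complex fps" where
  "fps_conj a = Abs_fps (\<lambda>n. (-1) ^ n * cnj (fps_nth a n))"

definition star_inv :: "'d mpoly fps \<Rightarrow> 'd mpoly fps" where
  "star_inv F = Abs_fps (\<lambda>n. (-1) ^ n * pcnj (fps_nth F n))"

section \<open>Kontsevich's star product\<close>

text \<open>
  An admissible graph of order \<open>n\<close> has aerial vertices \<open>0, \<dots>, n - 1\<close> and the two ground vertices
  \<open>n\<close> (left, placed at 0) and \<open>n + 1\<close> (right, placed at 1). The ordered edges starting at the aerial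
  vertex \<open>k\<close> are numbered \<open>2 * k\<close> and \<open>2 * k + 1\<close>, and a graph is the map \<open>t\<close> from edges to targets.
\<close>

definition kgraphs :: "nat \<Rightarrow> (nat \<Rightarrow> nat) set" where
  "kgraphs n =
     {t \<in> {..<2 * n} \<rightarrow>\<^sub>E {..<n + 2}.
        \<forall>k<n. t (2 * k) \<noteq> k \<and> t (2 * k + 1) \<noteq> k \<and> t (2 * k) \<noteq> t (2 * k + 1)}"

text \<open>
  A configuration of \<open>n\<close> points is given by its \<open>2 * n\<close> real coordinates: vertex \<open>k\<close> sits at
  \<open>x (2 * k) + \<i> x (2 * k + 1)\<close>.
\<close>

definition kpos :: "nat \<Rightarrow> (nat \<Rightarrow> real) \<Rightarrow> nat \<Rightarrow> complex" where
  "kpos n x v = (if v < n then Complex (x (2 * v)) (x (2 * v + 1)) else if v = n then 0 else 1)"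

definition kconfigs :: "nat \<Rightarrow> (nat \<Rightarrow> real) set" where
  "kconfigs n =
     {x \<in> {..<2 * n} \<rightarrow>\<^sub>E UNIV. (\<forall>k<n. Im (kpos n x k) > 0) \<and> inj_on (kpos n x) {..<n}}"

text \<open>
  The hyperbolic angle attached to the edge from \<open>p\<close> to \<open>q\<close> is the argument of
  \<open>z = (q - p) / (q - cnj p)\<close>. Its differential does not depend on the branch of the argument and is
  \<open>Im (dz / z)\<close>; \<open>kangle_deriv n t x e j\<close> is the partial derivative of the angle of edge \<open>e\<close> in the
  \<open>j\<close>-th coordinate.
\<close>

definition kratio :: "nat \<Rightarrow> (nat \<Rightarrow> nat) \<Rightarrow> nat \<Rightarrow> (nat \<Rightarrow> real) \<Rightarrow> complex" where
  "kratio n t e x =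
     (kpos n x (t e) - kpos n x (e div 2)) / (kpos n x (t e) - cnj (kpos n x (e div 2)))"

definition kangle_deriv :: "nat \<Rightarrow> (nat \<Rightarrow> nat) \<Rightarrow> (nat \<Rightarrow> real) \<Rightarrow> nat \<Rightarrow> nat \<Rightarrow> real" where
  "kangle_deriv n t x e j =
     Im (vector_derivative (\<lambda>s. kratio n t e (x(j := s))) (at (x j)) / kratio n t e x)"

text \<open>
  The weight \<open>1 / (n! (2\<pi>)\<^bsup>2n\<^esup>) \<integral> d\<phi>\<^sub>0 \<and> \<dots> \<and> d\<phi>\<^bsub>2n-1\<^esub>\<close>; the wedge of the differentials is the
  Jacobian determinant, here given by the Leibniz formula.
\<close>

definition kweight :: "nat \<Rightarrow> (nat \<Rightarrow> nat) \<Rightarrow> real" where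
  "kweight n t =
     (LINT x : kconfigs n | PiM {..<2 * n} (\<lambda>_. lborel).
        (\<Sum>\<sigma> | \<sigma> permutes {..<2 * n}. of_int (sign \<sigma>) * (\<Prod>e<2 * n. kangle_deriv n t x e (\<sigma> e))))
     / (fact n * (2 * pi) ^ (2 * n))"

text \<open>
  An edge with index \<open>i\<close> stands for the partial derivative in direction \<open>i\<close>, acting on its target.
\<close>

definition kbidiff ::
    "('d::finite \<Rightarrow> 'd \<Rightarrow> 'd mpoly) \<Rightarrow> nat \<Rightarrow> (nat \<Rightarrow> nat) \<Rightarrow> 'd mpoly \<Rightarrow> 'd mpoly \<Rightarrow> 'd mpoly" where
  "kbidiff a n t f g =
     (\<Sum>I \<in> {..<2 * n} \<rightarrow>\<^sub>E UNIV.
        let dv = (\<lambda>v. mderivs (map I (filter (\<lambda>e. t e = v) [0..<2 * n])))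
        in (\<Prod>k<n. dv k (a (I (2 * k)) (I (2 * k + 1)))) * dv n f * dv (n + 1) g)"

text \<open>
  With \<open>a = P / 2\<close> the first order term is half of the bracket, so that the commutator of the star
  product is \<open>\<nu>\<close> times the bracket to first order.
\<close>

definition kontsevich ::
    "('d::finite \<Rightarrow> 'd \<Rightarrow> 'd mpoly) \<Rightarrow> nat \<Rightarrow> 'd mpoly \<Rightarrow> 'd mpoly \<Rightarrow> 'd mpoly" where
  "kontsevich P n f g =
     (\<Sum>t \<in> kgraphs n. cst (of_real (kweight n t)) * kbidiff (\<lambda>i j. cst (1/2) * P i j) n t f g)"

section \<open>Duflo--Kontsevich star products\<close>

definition duflo_kontsevich_star ::
    "('d::finite \<Rightarrow> 'd \<Rightarrow> 'd mpoly) \<Rightarrow> (nat \<Rightarrow> 'd mpoly \<Rightarrow> 'd mpoly \<Rightarrow> 'd mpoly) \<Rightarrow> bool" where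
  "duflo_kontsevich_star P C \<longleftrightarrow>
     (\<forall>f g. C 0 f g = f * g) \<and>
     (\<forall>k\<ge>1. real_bidiff_operator (C k)) \<and>
     (\<forall>F G H. star C (star C F G) H = star C F (star C G H)) \<and>
     (\<forall>f g. C 1 f g - C 1 g f = bracket P f g) \<and>
     star_equivalent C (kontsevich P) \<and>
     (\<forall>F\<in>star_center C. \<forall>G\<in>star_center C. star C F G = F * G) \<and>
     (\<forall>F G. star_inv (star C F G) = star C (star_inv G) (star_inv F))"

section \<open>Modules and representations\<close>

text \<open>\<open>sm\<close> is the action of \<open>\<complex>[[\<nu>]]\<close> on the module, \<open>\<pi>\<close> that of \<open>A[[\<nu>]]\<close>.\<close>

definition fps_cst :: "complex fps \<Rightarrow> 'd mpoly fps" where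
  "fps_cst a = Abs_fps (\<lambda>n. cst (fps_nth a n))"

definition topological_module ::
    "(nat \<Rightarrow> 'd mpoly \<Rightarrow> 'd mpoly \<Rightarrow> 'd mpoly) \<Rightarrow> (complex fps \<Rightarrow> 'm::ab_group_add \<Rightarrow> 'm) \<Rightarrow>
     ('d mpoly fps \<Rightarrow> 'm \<Rightarrow> 'm) \<Rightarrow> bool" where
  "topological_module C sm \<pi> \<longleftrightarrow>
     module sm \<and>
     (\<forall>F G m. \<pi> (F + G) m = \<pi> F m + \<pi> G m) \<and>
     (\<forall>F m n. \<pi> F (m + n) = \<pi> F m + \<pi> F n) \<and>
     (\<forall>a F m. \<pi> (fps_cst a * F) m = sm a (\<pi> F m)) \<and>
     (\<forall>a F m. \<pi> F (sm a m) = sm a (\<pi> F m)) \<and>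
     (\<forall>m. \<pi> 1 m = m) \<and>
     (\<forall>F G m. \<pi> (star C F G) m = \<pi> F (\<pi> G m))"

definition nu_multiples :: "(complex fps \<Rightarrow> 'm::ab_group_add \<Rightarrow> 'm) \<Rightarrow> 'm set" where
  "nu_multiples sm = range (sm fps_X)"

definition hermitian_form ::
    "(complex fps \<Rightarrow> 'm::ab_group_add \<Rightarrow> 'm) \<Rightarrow> ('m \<Rightarrow> 'm \<Rightarrow> complex fps) \<Rightarrow> bool" where
  "hermitian_form sm h \<longleftrightarrow>
     (\<forall>u v w. h (u + v) w = h u w + h v w) \<and>
     (\<forall>a u v. h (sm a u) v = a * h u v) \<and>
     (\<forall>u v. h u v = fps_conj (h v u))"

text \<open>
  The induced form on \<open>M / \<nu>M\<close> sends the classes of \<open>u\<close> and \<open>v\<close> to the constant term of \<open>h u v\<close>.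
\<close>

definition strongly_nondegenerate ::
    "(complex fps \<Rightarrow> 'm::ab_group_add \<Rightarrow> 'm) \<Rightarrow> ('m \<Rightarrow> 'm \<Rightarrow> complex fps) \<Rightarrow> bool" where
  "strongly_nondegenerate sm h \<longleftrightarrow>
     (\<forall>u. (\<forall>v. h u v = 0) \<longrightarrow> u = 0) \<and>
     (\<forall>u. (\<forall>v. fps_nth (h u v) 0 = 0) \<longrightarrow> u \<in> nu_multiples sm)"

definition strongly_pseudo_unitary ::
    "(nat \<Rightarrow> 'd mpoly \<Rightarrow> 'd mpoly \<Rightarrow> 'd mpoly) \<Rightarrow> (complex fps \<Rightarrow> 'm::ab_group_add \<Rightarrow> 'm) \<Rightarrow>
     ('d mpoly fps \<Rightarrow> 'm \<Rightarrow> 'm) \<Rightarrow> bool" where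
  "strongly_pseudo_unitary C sm \<pi> \<longleftrightarrow>
     topological_module C sm \<pi> \<and>
     (\<exists>h. hermitian_form sm h \<and> strongly_nondegenerate sm h \<and>
          (\<forall>F u v. h (\<pi> F u) v = h u (\<pi> (star_inv F) v)))"

definition torsion_free :: "(complex fps \<Rightarrow> 'm::ab_group_add \<Rightarrow> 'm) \<Rightarrow> bool" where
  "torsion_free sm \<longleftrightarrow> inj (sm fps_X)"

text \<open>
  A polynomial \<open>f\<close> acts on \<open>M / \<nu>M\<close> through \<open>\<pi> f\<close>, so it annihilates this \<open>A\<close>-module iff \<open>\<pi> f\<close>
  maps \<open>M\<close> to \<open>\<nu>M\<close>.
\<close>

definition ann_quotient ::
    "(complex fps \<Rightarrow> 'm::ab_group_add \<Rightarrow> 'm) \<Rightarrow> ('d mpoly fps \<Rightarrow> 'm \<Rightarrow> 'm) \<Rightarrow> 'd mpoly set" where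
  "ann_quotient sm \<pi> = {f. \<forall>m. \<pi> (fps_const f) m \<in> nu_multiples sm}"

definition char_variety ::
    "(complex fps \<Rightarrow> 'm::ab_group_add \<Rightarrow> 'm) \<Rightarrow> ('d::finite mpoly fps \<Rightarrow> 'm \<Rightarrow> 'm) \<Rightarrow> (complex ^ 'd) set" where
  "char_variety sm \<pi> = zeros (ann_quotient sm \<pi>)"

definition annihilator :: "('d mpoly fps \<Rightarrow> 'm::ab_group_add \<Rightarrow> 'm) \<Rightarrow> 'd mpoly fps set" where
  "annihilator \<pi> = {F. \<forall>m. \<pi> F m = 0}"

text \<open>
  Identifying \<open>A\<close> with \<open>A[[\<nu>]] / \<nu>A[[\<nu>]]\<close>, the ideal \<open>Ann M / (Ann M \<inter> \<nu>A[[\<nu>]])\<close> is the set of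
  constant terms of the annihilator.
\<close>

definition poisson_char_variety ::
    "('d::finite mpoly fps \<Rightarrow> 'm::ab_group_add \<Rightarrow> 'm) \<Rightarrow> (complex ^ 'd) set" where
  "poisson_char_variety \<pi> = zeros ((\<lambda>F. fps_nth F 0) ` annihilator \<pi>)"

end

theory Submission
  imports Defs "HOL-Computational_Algebra.Primes"
begin

text \<open>
  If \<open>\<pi> f\<close> maps \<open>M\<close> into \<open>\<nu>M\<close>, then \<open>\<langle>\<pi>(f\<^sup>*)u, v\<rangle> = \<langle>u, \<pi>(f)v\<rangle>\<close> has zero constant term for all
  \<open>u, v\<close>, and strong non-degeneracy gives \<open>\<pi>(f\<^sup>*)u \<in> \<nu>M\<close>. So the annihilator of \<open>M / \<nu>M\<close> is an ideal
  stable under \<open>f \<mapsto> f\<^sup>*\<close>; by non-degeneracy the same holds for the constant terms of \<open>Ann M\<close>.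
  The zero set of such an ideal is cut out by the polynomials \<open>f + f\<^sup>*\<close> and \<open>\<i>(f - f\<^sup>*)\<close>, with \<open>f\<close> in
  the ideal, which have real coefficients, and Hilbert's basis theorem reduces these to finitely many.
\<close>

section \<open>Evaluation and conjugation of polynomials\<close>

lemma peval_single: "peval (Poly_Mapping.single m c) \<xi> = c * (\<Prod>i\<in>UNIV. vec_nth \<xi> i ^ Poly_Mapping.lookup m i)"
  by (simp add: peval_def)

lemma peval_zero [simp]: "peval 0 \<xi> = 0"
  by (simp add: peval_def)

lemma peval_add: "peval (f + g) \<xi> = peval f \<xi> + peval g \<xi>"
  unfolding peval_def by (rule setsum_keys_plus_distrib) (simp_all add: distrib_right)

lemma peval_sum: "peval (\<Sum>x\<in>A. f x) \<xi> = (\<Sum>x\<in>A. peval (f x) \<xi>)"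
  by (induction A rule: infinite_finite_induct) (simp_all add: peval_add)

lemma sum_single_keys: "(\<Sum>m\<in>Poly_Mapping.keys f. Poly_Mapping.single m (Poly_Mapping.lookup f m)) = f"
  by (rule poly_mapping_eqI) (simp add: lookup_sum lookup_single when_def in_keys_iff)

lemma single_mult_eq_sum:
  "Poly_Mapping.single d c * f =
     (\<Sum>m\<in>Poly_Mapping.keys f. Poly_Mapping.single (d + m) (c * Poly_Mapping.lookup f m))"
proof -
  have "Poly_Mapping.single d c * f =
      Poly_Mapping.single d c * (\<Sum>m\<in>Poly_Mapping.keys f. Poly_Mapping.single m (Poly_Mapping.lookup f m))"
    by (simp only: sum_single_keys)
  then show ?thesis
    by (simp add: sum_distrib_left mult_single)
qed

lemma peval_mult: "peval (f * g) \<xi> = peval f \<xi> * peval g \<xi>"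
proof -
  have single: "peval (Poly_Mapping.single d c * g) \<xi> = peval (Poly_Mapping.single d c) \<xi> * peval g \<xi>" for d c
    by (simp add: single_mult_eq_sum peval_sum peval_single)
       (simp add: peval_def lookup_add power_add prod.distrib sum_distrib_left mult_ac)
  have "peval (f * g) \<xi> =
      peval ((\<Sum>m\<in>Poly_Mapping.keys f. Poly_Mapping.single m (Poly_Mapping.lookup f m)) * g) \<xi>"
    by (simp only: sum_single_keys)
  also have "\<dots> = (\<Sum>m\<in>Poly_Mapping.keys f. peval (Poly_Mapping.single m (Poly_Mapping.lookup f m)) \<xi>) * peval g \<xi>"
    by (simp only: sum_distrib_right peval_sum single)
  also have "\<dots> = peval f \<xi> * peval g \<xi>"
    by (simp only: peval_sum [symmetric] sum_single_keys)
  finally show ?thesis .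
qed

text \<open>Translation by \<open>d\<close> is injective on exponents, so a single term survives.
  The division step uses this to find the coefficient to be cancelled.\<close>

lemma lookup_single_mult_add:
  fixes d m :: "'a \<Rightarrow>\<^sub>0 nat"
  shows "Poly_Mapping.lookup (Poly_Mapping.single d c * f) (d + m) = c * Poly_Mapping.lookup f m"
  by (simp add: single_mult_eq_sum lookup_sum lookup_single when_def in_keys_iff)

lemma lookup_pcnj [simp]: "Poly_Mapping.lookup (pcnj f) m = cnj (Poly_Mapping.lookup f m)"
  by (simp add: pcnj_def Poly_Mapping.map.rep_eq when_def)

lemma pcnj_pcnj [simp]: "pcnj (pcnj f) = f"
  by (rule poly_mapping_eqI) simp

lemma pcnj_zero [simp]: "pcnj 0 = 0"
  by (rule poly_mapping_eqI) simp

lemma lookup_cst_mult: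
  fixes f :: "'d mpoly"
  shows "Poly_Mapping.lookup (cst c * f) m = c * Poly_Mapping.lookup f m"
  using lookup_single_mult_add [of 0 c f m] by simp

section \<open>Hilbert's basis theorem\<close>

text \<open>A decreasing sequence of naturals is constant once its least value is reached, so a tail
  of a decreasing subsequence is also increasing.\<close>

lemma incseq_subsequence:
  fixes s :: "nat \<Rightarrow> nat"
  obtains r where "strict_mono r" "incseq (s \<circ> r)"
proof -
  obtain r where r: "strict_mono r" "monoseq (\<lambda>n. s (r n))"
    using seq_monosub by blast
  show ?thesis
  proof (cases "incseq (s \<circ> r)")
    case False
    then have dec: "decseq (s \<circ> r)"
      using r(2) by (simp add: monoseq_iff comp_def)
    obtain N where "\<And>n. s (r N) \<le> s (r n)"
      using ex_has_least_nat [of "\<lambda>_. True" 0 "\<lambda>n. s (r n)"] by blast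
    then have "s (r (N + n)) = s (r N)" for n
      using dec by (metis decseqD comp_apply le_add1 le_antisym)
    then have "incseq (s \<circ> (\<lambda>n. r (N + n)))"
      by (simp add: incseq_def)
    moreover have "strict_mono (\<lambda>n. r (N + n))"
      using r(1) by (simp add: strict_mono_def)
    ultimately show ?thesis
      using that by blast
  qed (use r that in blast)
qed

lemma incseq_subsequence_components:
  fixes s :: "nat \<Rightarrow> 'i \<Rightarrow> nat"
  assumes "finite D"
  shows "\<exists>r. strict_mono r \<and> (\<forall>i\<in>D. incseq (\<lambda>n. s (r n) i))"
  using assms
proof induction
  case empty
  show ?case
    using strict_mono_id by auto
next
  case (insert i D)
  then obtain r where r: "strict_mono r" "\<forall>i\<in>D. incseq (\<lambda>n. s (r n) i)"
    by blast
  obtain q where q: "strict_mono q" "incseq ((\<lambda>n. s (r n) i) \<circ> q)"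
    using incseq_subsequence by blast
  have "incseq (\<lambda>n. s ((r \<circ> q) n) j)" if "j \<in> insert i D" for j
    using that r(2) q strict_mono_less_eq[OF q(1)] by (auto simp: incseq_def)
  moreover have "strict_mono (r \<circ> q)"
    using r(1) q(1) by (rule strict_mono_o)
  ultimately show ?case
    by blast
qed

text \<open>In the componentwise order, which is divisibility of monomials, the minimal elements of
  \<open>L\<close> form an antichain; antichains are finite, and every element of \<open>L\<close>
  lies above a minimal one.\<close>

lemma Dickson:
  fixes L :: "('d::finite \<Rightarrow>\<^sub>0 nat) set"
  obtains L0 where "finite L0" "L0 \<subseteq> L"
    "\<And>l. l \<in> L \<Longrightarrow> \<exists>l0\<in>L0. \<exists>d. l = d + l0"
proof -
  define le where "le a b \<longleftrightarrow> (\<forall>i. Poly_Mapping.lookup a i \<le> Poly_Mapping.lookup b i)"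
    for a b :: "'d \<Rightarrow>\<^sub>0 nat"
  define L0 where "L0 = {l \<in> L. \<forall>k\<in>L. le k l \<longrightarrow> k = l}"
  have "finite L0"
  proof (rule ccontr)
    assume "infinite L0"
    then obtain s :: "nat \<Rightarrow> 'd \<Rightarrow>\<^sub>0 nat" where s: "inj s" "range s \<subseteq> L0"
      using infinite_countable_subset by blast
    \<comment> \<open>A subsequence increasing in every coordinate makes two distinct minimal
      elements comparable.\<close>
    obtain r where r: "strict_mono r" "\<forall>i\<in>UNIV. incseq (\<lambda>n. Poly_Mapping.lookup (s (r n)) i)"
      using incseq_subsequence_components [of UNIV "\<lambda>n. Poly_Mapping.lookup (s n)"] by auto
    have "le (s (r 0)) (s (r 1))"
      using r(2) by (auto simp: le_def incseq_def)
    then have "s (r 0) = s (r 1)"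
      using s(2) unfolding L0_def by blast
    then show False
      using s(1) r(1) by (metis injD strict_mono_eq zero_neq_one)
  qed
  moreover have "\<exists>l0\<in>L0. \<exists>d. l = d + l0" if "l \<in> L" for l
  proof -
    define sz where "sz k = (\<Sum>i\<in>UNIV. Poly_Mapping.lookup k i)" for k :: "'d \<Rightarrow>\<^sub>0 nat"
    have "l \<in> L \<and> le l l"
      using that by (simp add: le_def)
    \<comment> \<open>An element below \<open>l\<close> of least total degree \<open>sz\<close> is
      minimal in \<open>L\<close>.\<close>
    from ex_has_least_nat [of "\<lambda>k. k \<in> L \<and> le k l", OF this, of sz]
    obtain k where k: "k \<in> L" "le k l" and min: "\<And>j. j \<in> L \<Longrightarrow> le j l \<Longrightarrow> sz k \<le> sz j"
      by blast
    have "j = k" if j: "j \<in> L" "le j k" for j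
    proof (rule ccontr)
      assume "j \<noteq> k"
      then obtain i where "Poly_Mapping.lookup j i \<noteq> Poly_Mapping.lookup k i"
        using poly_mapping_eqI [of j k] by blast
      then have "Poly_Mapping.lookup j i < Poly_Mapping.lookup k i"
        using j(2) by (simp add: le_def le_neq_implies_less)
      then have "sz j < sz k"
        unfolding sz_def using j(2) by (intro sum_strict_mono_ex1) (auto simp: le_def)
      moreover have "le j l"
        using j(2) k(2) by (auto simp: le_def intro: le_trans)
      ultimately show False
        using min [OF j(1)] by simp
    qed
    then have "k \<in> L0"
      using k(1) by (auto simp: L0_def)
    moreover have "\<exists>d. l = d + k"
      by (rule exI [of _ "l - k"])
         (use k(2) in \<open>intro poly_mapping_eqI, simp add: lookup_add lookup_minus le_def\<close>)
    ultimately show ?thesis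
      by blast
  qed
  ultimately show ?thesis
    using that [of L0] by (auto simp: L0_def)
qed

text \<open>
  The order of the values of such a \<open>w\<close> is a monomial order; encoding exponents by products of prime
  powers realises it without choosing an order on the variables.
\<close>

lemma multiplicative_weight_exists:
  obtains w :: "('d::finite \<Rightarrow>\<^sub>0 nat) \<Rightarrow> nat" where
    "inj w" "\<And>a b. w (a + b) = w a * w b" "\<And>a. w a > 0"
proof -
  obtain p :: "'d \<Rightarrow> nat" where p: "inj p" "range p \<subseteq> {q. prime q}"
  proof -
    obtain Q :: "nat set" where Q: "finite Q" "card Q = CARD('d)" "Q \<subseteq> {q. prime q}"
      using infinite_arbitrarily_large [OF primes_infinite] by blast
    then obtain p :: "'d \<Rightarrow> nat" where "bij_betw p UNIV Q"
      using finite_same_card_bij [OF finite, of Q] by metis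
    then show ?thesis
      using that [of p] Q(3) by (auto simp: bij_betw_def)
  qed
  define w where "w m = (\<Prod>i\<in>UNIV. p i ^ Poly_Mapping.lookup m i)" for m :: "'d \<Rightarrow>\<^sub>0 nat"
  have pr: "prime (p i)" for i
    using p(2) by auto
  \<comment> \<open>Unique factorisation recovers each exponent from \<open>w m\<close>, whence
    injectivity.\<close>
  have mult: "multiplicity (p i) (w m) = Poly_Mapping.lookup m i" for m i
  proof -
    have "w m = (\<Prod>q\<in>range p. q ^ Poly_Mapping.lookup m (inv p q))"
      using p(1) by (simp add: w_def prod.reindex)
    moreover have "multiplicity (p i) (\<Prod>q\<in>range p. q ^ Poly_Mapping.lookup m (inv p q)) =
        (if p i \<in> range p then Poly_Mapping.lookup m (inv p (p i)) else 0)"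
      by (rule multiplicity_prod_prime_powers) (use pr in auto)
    ultimately show ?thesis
      using p(1) by simp
  qed
  have "inj w"
    by (rule injI, rule poly_mapping_eqI) (metis mult)
  moreover have "w (a + b) = w a * w b" for a b
    by (simp add: w_def lookup_add power_add prod.distrib)
  moreover have "w a > 0" for a
    using pr by (simp add: w_def prime_gt_0_nat)
  ultimately show ?thesis
    using that by blast
qed

section \<open>Ideals and reduction by leading terms\<close>

definition is_ideal :: "'a::comm_ring_1 set \<Rightarrow> bool" where
  "is_ideal I \<longleftrightarrow> (\<forall>f\<in>I. \<forall>g\<in>I. f + g \<in> I) \<and> (\<forall>f\<in>I. \<forall>g. g * f \<in> I)"

lemma is_ideal_diff: "f - g \<in> I" if "is_ideal I" "f \<in> I" "g \<in> I"
proof -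
  have "(- 1) * g \<in> I"
    using that by (simp only: is_ideal_def)
  then have "f + (- 1) * g \<in> I"
    using that by (simp only: is_ideal_def)
  then show ?thesis
    by simp
qed

text \<open>Dickson's lemma selects finitely many leading exponents of \<open>I\<close>; one member
  of \<open>I\<close> is chosen for each. Dividing any member of \<open>I\<close> by these leaves no
  remainder. Instead of the quotients, only the vanishing at a common zero is tracked.\<close>

lemma zeros_finite_subset:
  fixes I :: "'d::finite mpoly set"
  assumes I: "is_ideal I"
  obtains B where "finite B" "B \<subseteq> I" "zeros B = zeros I"
proof -
  obtain w :: "('d \<Rightarrow>\<^sub>0 nat) \<Rightarrow> nat" where
    w: "inj w" "\<And>a b. w (a + b) = w a * w b" "\<And>a. w a > 0"
    using multiplicative_weight_exists by blast
  define leads where "leads f l \<longleftrightarrow>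
      l \<in> Poly_Mapping.keys f \<and> (\<forall>k\<in>Poly_Mapping.keys f. w k \<le> w l)" for f :: "'d mpoly" and l
  obtain L0 where L0: "finite L0" "L0 \<subseteq> {l. \<exists>f\<in>I. leads f l}"
    "\<And>l. l \<in> {l. \<exists>f\<in>I. leads f l} \<Longrightarrow> \<exists>l0\<in>L0. \<exists>d. l = d + l0"
    using Dickson [of "{l. \<exists>f\<in>I. leads f l}"] by blast
  from L0(2) have "\<forall>l\<in>L0. \<exists>f. f \<in> I \<and> leads f l"
    by blast
  then obtain b where b: "\<And>l. l \<in> L0 \<Longrightarrow> b l \<in> I" "\<And>l. l \<in> L0 \<Longrightarrow> leads (b l) l"
    by metis
  \<comment> \<open>Induction on a strict bound \<open>n\<close> for the weights of the exponents;
    each division step lowers it by one.\<close>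
  have vanish: "peval f \<xi> = 0"
    if \<xi>: "\<xi> \<in> zeros (b ` L0)" and "f \<in> I" "\<forall>k\<in>Poly_Mapping.keys f. w k < n" for \<xi> f n
    using that(2,3)
  proof (induction n arbitrary: f)
    case 0
    then have "f = 0"
      by (metis keys_eq_empty equals0I not_less0)
    then show ?case
      by simp
  next
    case (Suc n)
    show ?case
    proof (cases "\<exists>l\<in>Poly_Mapping.keys f. w l = n")
      case False
      then show ?thesis
        using Suc by (metis less_Suc_eq)
    next
      case True
      then obtain l where l: "l \<in> Poly_Mapping.keys f" "w l = n"
        by blast
      have "leads f l"
        using l Suc.prems(2) by (auto simp: leads_def less_Suc_eq_le)
      then obtain l0 d where d: "l0 \<in> L0" "l = d + l0"
        using L0(3) Suc.prems(1) by blast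
      \<comment> \<open>Chosen so that \<open>q\<close> has the same coefficient as \<open>f\<close>
        at \<open>l\<close>.\<close>
      define c where "c = Poly_Mapping.lookup f l / Poly_Mapping.lookup (b l0) l0"
      define q where "q = Poly_Mapping.single d c * b l0"
      have "Poly_Mapping.lookup (b l0) l0 \<noteq> 0"
        using b(2) [OF d(1)] by (simp add: leads_def in_keys_iff)
      then have q_l: "Poly_Mapping.lookup q l = Poly_Mapping.lookup f l"
        by (simp add: q_def d(2) lookup_single_mult_add c_def)
      have q_le: "w k \<le> n" if k: "k \<in> Poly_Mapping.keys q" for k
      proof -
        have "k \<in> {a + e | a e. a \<in> Poly_Mapping.keys (Poly_Mapping.single d c) \<and> e \<in> Poly_Mapping.keys (b l0)}"
          using k keys_mult unfolding q_def by blast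
        then obtain e where "k = d + e" "e \<in> Poly_Mapping.keys (b l0)"
          by (auto split: if_splits)
        \<comment> \<open>Multiplicativity of \<open>w\<close> makes multiplication by a monomial
          preserve the order: \<open>w (d + e) \<le> w (d + l0) = n\<close>.\<close>
        then show ?thesis
          using b(2) [OF d(1)] w(2,3) d(2) l(2) by (auto simp: leads_def)
      qed
      have "\<forall>k\<in>Poly_Mapping.keys (f - q). w k < n"
      proof
        fix k assume k: "k \<in> Poly_Mapping.keys (f - q)"
        then have "k \<noteq> l"
          using q_l by (auto simp: in_keys_iff lookup_minus)
        \<comment> \<open>As \<open>w\<close> is injective, \<open>l\<close> is the only exponent of
          weight \<open>n\<close>.\<close>
        then have "w k \<noteq> n"
          using l(2) w(1) by (auto dest: injD)
        moreover have "w k \<le> n"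
          using k keys_diff [of f q] q_le Suc.prems(2) by (auto simp: less_Suc_eq_le)
        ultimately show "w k < n"
          by simp
      qed
      moreover have "q \<in> I"
        using I b(1) [OF d(1)] by (simp add: q_def is_ideal_def)
      then have "f - q \<in> I"
        using I Suc.prems(1) by (simp add: is_ideal_diff)
      ultimately have "peval (f - q) \<xi> = 0"
        using Suc.IH by blast
      moreover have "peval q \<xi> = 0"
        using \<xi> d(1) by (simp add: q_def peval_mult zeros_def)
      ultimately show ?thesis
        using peval_add [of "f - q" q \<xi>] by simp
    qed
  qed
  have "zeros (b ` L0) \<subseteq> zeros I"
  proof
    fix \<xi> assume \<xi>: "\<xi> \<in> zeros (b ` L0)"
    have "peval f \<xi> = 0" if "f \<in> I" for f
      by (rule vanish [OF \<xi> that, of "Suc (Max (w ` Poly_Mapping.keys f))"])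
         (simp add: less_Suc_eq_le)
    then show "\<xi> \<in> zeros I"
      by (simp add: zeros_def)
  qed
  moreover have "b ` L0 \<subseteq> I"
    using b(1) by blast
  moreover from this have "zeros I \<subseteq> zeros (b ` L0)"
    by (auto simp: zeros_def)
  ultimately show ?thesis
    using that [of "b ` L0"] L0(1) by blast
qed

section \<open>Real equations for conjugation-stable ideals\<close>

lemma real_variety_zeros:
  fixes I :: "'d::finite mpoly set"
  assumes I: "is_ideal I" and conj: "\<And>f. f \<in> I \<Longrightarrow> pcnj f \<in> I"
  shows "real_variety (zeros I)"
proof -
  obtain B where B: "finite B" "B \<subseteq> I" "zeros B = zeros I"
    using zeros_finite_subset [OF I] .
  \<comment> \<open>The coefficients of \<open>re f\<close> are twice the real parts of those of
    \<open>f\<close>, those of \<open>im f\<close> minus twice the imaginary parts. Since both lie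
    in the ideal and \<open>f\<close> is a complex combination of them, the zero sets agree.\<close>
  define re where "re f = f + pcnj f" for f :: "'d mpoly"
  define im where "im f = cst \<i> * (f - pcnj f)" for f :: "'d mpoly"
  have "real_poly (re f)" "real_poly (im f)" for f
    by (auto simp: real_poly_def re_def im_def lookup_add lookup_cst_mult lookup_minus complex_is_Real_iff)
  moreover have "re f \<in> I" "im f \<in> I" if "f \<in> B" for f
    using that B(2) I conj is_ideal_diff [OF I] by (auto simp: re_def im_def is_ideal_def)
  then have "zeros I \<subseteq> zeros (re ` B \<union> im ` B)"
    by (auto simp: zeros_def)
  moreover have decomp: "f = cst (1/2) * re f + cst (- \<i>/2) * im f" for f
    by (rule poly_mapping_eqI)
       (simp add: re_def im_def lookup_add lookup_cst_mult lookup_minus, simp add: complex_eq_iff)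
  have "peval f \<xi> = 0" if "peval (re f) \<xi> = 0" "peval (im f) \<xi> = 0" for f \<xi>
    by (subst decomp) (simp add: peval_add peval_mult that)
  then have "zeros (re ` B \<union> im ` B) \<subseteq> zeros B"
    by (auto simp: zeros_def)
  ultimately show ?thesis
    unfolding real_variety_def using B(1,3)
    by (intro exI [of _ "re ` B \<union> im ` B"]) auto
qed

section \<open>Annihilators of pseudo-unitary modules\<close>

lemma star_inv_star_inv [simp]:
  fixes F :: "'d mpoly fps"
  shows "star_inv (star_inv F) = F"
proof -
  have "(- 1) ^ n * pcnj ((- 1) ^ n * pcnj f) = f" for n :: nat and f :: "'d mpoly"
    by (cases "even n") (auto intro!: poly_mapping_eqI)
  then show ?thesis
    by (simp add: star_inv_def fps_eq_iff)
qed

lemma star_inv_const: "star_inv (fps_const f) = fps_const (pcnj f)"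
  by (auto simp: star_inv_def fps_eq_iff)

lemma fps_cst_X: "fps_cst fps_X = fps_X"
  by (auto simp: fps_cst_def fps_eq_iff fps_X_def)

context
  fixes C :: "nat \<Rightarrow> 'd::finite mpoly \<Rightarrow> 'd mpoly \<Rightarrow> 'd mpoly"
    and sm :: "complex fps \<Rightarrow> 'm::ab_group_add \<Rightarrow> 'm"
    and \<pi> :: "'d mpoly fps \<Rightarrow> 'm \<Rightarrow> 'm"
  assumes C0: "\<And>f g. C 0 f g = f * g"
    and spu: "strongly_pseudo_unitary C sm \<pi>"
begin

text \<open>Modulo \<nu> the star product is the commutative one, so star multiples of a series lift
  ideal multiples of its constant term.\<close>

lemma star_nth_0: "fps_nth (star C F G) 0 = fps_nth F 0 * fps_nth G 0"
  by (simp add: star_def C0)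

lemma action:
  "module sm"
  "\<pi> (F + G) m = \<pi> F m + \<pi> G m"
  "\<pi> F (m + n) = \<pi> F m + \<pi> F n"
  "\<pi> (fps_cst a * F) m = sm a (\<pi> F m)"
  "\<pi> F (sm a m) = sm a (\<pi> F m)"
  "\<pi> (star C F G) m = \<pi> F (\<pi> G m)"
  using spu by (simp_all add: strongly_pseudo_unitary_def topological_module_def)

lemma action_zero: "\<pi> F 0 = 0"
  using action(3) [of F 0 0] by simp

lemma nu_multiples_add: "u \<in> nu_multiples sm \<Longrightarrow> v \<in> nu_multiples sm \<Longrightarrow> u + v \<in> nu_multiples sm"
  by (auto simp: nu_multiples_def simp flip: module.scale_right_distrib [OF action(1)])

text \<open>Series with equal constant terms differ by a multiple of \<nu>, which acts into \<nu>M.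
  Hence any lift of a polynomial may be tested, in particular a star product of constants, which
  need not be constant.\<close>

lemma ann_quotient_iff_constant_term:
  "fps_nth F 0 \<in> ann_quotient sm \<pi> \<longleftrightarrow> (\<forall>m. \<pi> F m \<in> nu_multiples sm)"
proof -
  have decomp: "\<exists>R. F = fps_cst fps_X * R + G" if "fps_nth F 0 = fps_nth G 0" for F G :: "'d mpoly fps"
  proof
    show "F = fps_cst fps_X * Abs_fps (\<lambda>n. fps_nth F (Suc n) - fps_nth G (Suc n)) + G"
      using that by (auto simp: fps_cst_X fps_eq_iff split: nat.split)
  qed
  have "\<pi> F m \<in> nu_multiples sm"
    if eq: "fps_nth F 0 = fps_nth G 0" and G: "\<pi> G m \<in> nu_multiples sm" for F G m
  proof -
    obtain R where "F = fps_cst fps_X * R + G"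
      using decomp eq by blast
    then show ?thesis
      using G by (auto simp: action intro!: nu_multiples_add) (simp add: nu_multiples_def)
  qed
  from this [of F "fps_const (fps_nth F 0)"] this [of "fps_const (fps_nth F 0)" F]
  show ?thesis
    unfolding ann_quotient_def by auto
qed

section \<open>The annihilator of M / \<nu>M\<close>

lemma is_ideal_ann_quotient: "is_ideal (ann_quotient sm \<pi>)"
  unfolding is_ideal_def
proof safe
  fix f g assume "f \<in> ann_quotient sm \<pi>" "g \<in> ann_quotient sm \<pi>"
  then show "f + g \<in> ann_quotient sm \<pi>"
    by (auto simp: ann_quotient_def action nu_multiples_add simp flip: fps_const_add)
next
  fix f g assume f: "f \<in> ann_quotient sm \<pi>"
  \<comment> \<open>The action commutes with \<nu> and therefore preserves \<nu>M.\<close>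
  have "\<pi> (star C (fps_const g) (fps_const f)) m \<in> nu_multiples sm" for m
  proof -
    obtain x where "\<pi> (fps_const f) m = sm fps_X x"
      using f by (auto simp: ann_quotient_def nu_multiples_def)
    then show ?thesis
      by (simp add: action nu_multiples_def)
  qed
  then show "g * f \<in> ann_quotient sm \<pi>"
    using ann_quotient_iff_constant_term [of "star C (fps_const g) (fps_const f)"]
    by (simp add: star_nth_0)
qed

text \<open>The adjoint relation is rewritten with the involution in the left slot, where
  non-degeneracy is stated.\<close>

lemma pseudo_unitary_form:
  obtains h where "hermitian_form sm h" "strongly_nondegenerate sm h"
    "\<And>F u v. h (\<pi> (star_inv F) u) v = h u (\<pi> F v)"
  using spu unfolding strongly_pseudo_unitary_def by (metis star_inv_star_inv)

lemma pcnj_ann_quotient: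
  assumes f: "f \<in> ann_quotient sm \<pi>"
  shows "pcnj f \<in> ann_quotient sm \<pi>"
proof -
  obtain h where h: "hermitian_form sm h" "strongly_nondegenerate sm h"
    "\<And>F u v. h (\<pi> (star_inv F) u) v = h u (\<pi> F v)"
    using pseudo_unitary_form by blast
  have "fps_nth (h (\<pi> (fps_const (pcnj f)) u) v) 0 = 0" for u v
  proof -
    obtain x where x: "\<pi> (fps_const f) v = sm fps_X x"
      using f by (auto simp: ann_quotient_def nu_multiples_def)
    have "h (\<pi> (fps_const (pcnj f)) u) v = h u (sm fps_X x)"
      using h(3) [of "fps_const f"] by (simp add: star_inv_const x)
    \<comment> \<open>Linearity is given in the left slot only; hermitian symmetry brings \<nu>
      there, and conjugation keeps the constant term zero.\<close>
    also have "\<dots> = fps_conj (fps_X * h x u)"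
      using h(1) unfolding hermitian_form_def by metis
    finally show ?thesis
      by (simp add: fps_conj_def)
  qed
  then show ?thesis
    using h(2) by (auto simp: strongly_nondegenerate_def ann_quotient_def)
qed

section \<open>Constant terms of the annihilator of M\<close>

lemma is_ideal_annihilator: "is_ideal ((\<lambda>F. fps_nth F 0) ` annihilator \<pi>)"
  unfolding is_ideal_def
proof safe
  fix F G assume "F \<in> annihilator \<pi>" "G \<in> annihilator \<pi>"
  then have "F + G \<in> annihilator \<pi>"
    by (simp add: annihilator_def action)
  then show "fps_nth F 0 + fps_nth G 0 \<in> (\<lambda>F. fps_nth F 0) ` annihilator \<pi>"
    by (metis fps_add_nth imageI)
next
  fix F g assume "F \<in> annihilator \<pi>"
  then have "star C (fps_const g) F \<in> annihilator \<pi>"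
    by (simp add: annihilator_def action action_zero)
  then show "g * fps_nth F 0 \<in> (\<lambda>F. fps_nth F 0) ` annihilator \<pi>"
    by (metis (mono_tags, lifting) star_nth_0 fps_nth_fps_const imageI)
qed

text \<open>Here the form with values in power series must be non-degenerate: the pairing vanishes
  entirely, and the conclusion is an exact zero rather than membership in \<nu>M.\<close>

lemma star_inv_annihilator:
  assumes F: "F \<in> annihilator \<pi>"
  shows "star_inv F \<in> annihilator \<pi>"
proof -
  obtain h where h: "hermitian_form sm h" "strongly_nondegenerate sm h"
    "\<And>F u v. h (\<pi> (star_inv F) u) v = h u (\<pi> F v)"
    using pseudo_unitary_form by blast
  have "h 0 u = 0" for u
    using h(1) unfolding hermitian_form_def by (metis add_cancel_right_left)
  then have "h u 0 = 0" for u
    using h(1) unfolding hermitian_form_def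
    by (metis fps_conj_def fps_ext fps_nth_Abs_fps fps_zero_nth complex_cnj_zero mult_zero_right)
  then have "h (\<pi> (star_inv F) u) v = 0" for u v
    using F by (simp add: h(3) annihilator_def)
  then show ?thesis
    using h(2) by (auto simp: strongly_nondegenerate_def annihilator_def)
qed

lemma real_varieties:
  "real_variety (char_variety sm \<pi>)" "real_variety (poisson_char_variety \<pi>)"
proof -
  show "real_variety (char_variety sm \<pi>)"
    unfolding char_variety_def
    by (intro real_variety_zeros is_ideal_ann_quotient pcnj_ann_quotient)
  \<comment> \<open>The sign in \<open>star_inv\<close> is trivial in degree zero, so its constant
    term is the conjugate of that of \<open>F\<close>.\<close>
  have "pcnj (fps_nth F 0) \<in> (\<lambda>F. fps_nth F 0) ` annihilator \<pi>" if "F \<in> annihilator \<pi>" for F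
    using star_inv_annihilator [OF that] by (force simp: star_inv_def)
  then show "real_variety (poisson_char_variety \<pi>)"
    unfolding poisson_char_variety_def
    by (intro real_variety_zeros is_ideal_annihilator) auto
qed

end

theorem mainTheorem5:
  fixes P :: "'d::finite \<Rightarrow> 'd \<Rightarrow> 'd mpoly"
    and C :: "nat \<Rightarrow> 'd mpoly \<Rightarrow> 'd mpoly \<Rightarrow> 'd mpoly"
    and sm :: "complex fps \<Rightarrow> 'm::ab_group_add \<Rightarrow> 'm"
    and \<pi> :: "'d mpoly fps \<Rightarrow> 'm \<Rightarrow> 'm"
  assumes "poisson_structure P"
    and "duflo_kontsevich_star P C"
    and "strongly_pseudo_unitary C sm \<pi>"
  shows "real_variety (char_variety sm \<pi>) \<and>
    (torsion_free sm \<longrightarrow> real_variety (poisson_char_variety \<pi>))"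
  using real_varieties [OF _ assms(3)] assms(2) by (simp add: duflo_kontsevich_star_def)

end
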